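(* For any bounded lattice $L$ and binary operation $\to$ on $L$, the following are equivalent: 1. $\to$ is a preconditional satisfying modus ponens ($a\wedge(a\to b)\leq b$ for all $a,b\in L$) and $(a\to 0)\to 0=a$ for all $a\in L$; 2. $L$ equipped with the unary operation $\neg$ defined by $\neg a:=a\to 0$ is an orthomodular lattice, and $\to$ coincides with the Sasaki hook, i.e., $a\to b=\neg a\vee(a\wedge b)$ for all $a,b\in L$.
   Context: A preconditional on a bounded lattice $L$ is a binary operation $\to$ on $L$ such that for all $a,b,c\in L$: (1) $1\to a\leq a$; (2) $a\wedge b\leq a\to b$; (3) $a\to b\leq a\to(a\wedge b)$; (4) $a\to(b\wedge c)\leq a\to b$; (5) $a\to((a\wedge b)\to c)\leq (a\wedge b)\to c$. An ortholattice is a bounded lattice equipped with a unary operation $\neg$ satisfying antitonicity ($a\leq b$ implies $\neg b\leq\neg a$), semicomplementation ($a\wedge\neg a=0$), and involution ($\neg\neg a=a$). An ortholattice is orthomodular if $a\leq b$ implies $b=a\vee(\neg a\wedge b)$. *)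

theory Defs
  imports "HOL-Library.Complemented_Lattices"
begin

locale preconditional =
  fixes imp :: "'a::bounded_lattice \<Rightarrow> 'a \<Rightarrow> 'a" (infixr "\<rightarrow>" 60)
  assumes top_imp: "(top \<rightarrow> a) \<le> a"
    and inf_le_imp: "inf a b \<le> (a \<rightarrow> b)"
    and imp_le_imp_inf: "(a \<rightarrow> b) \<le> (a \<rightarrow> inf a b)"
    and imp_inf_le: "(a \<rightarrow> inf b c) \<le> (a \<rightarrow> b)"
    and imp_inf_imp_le: "(a \<rightarrow> (inf a b \<rightarrow> c)) \<le> (inf a b \<rightarrow> c)"

text \<open>The library class of orthomodular lattices, relative to an arbitrary unary operation
  on a given bounded lattice. The class also carries a subtraction, which its axioms force
  to be the one supplied here. Besides the ortholattice axioms of antitonicity,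
  semicomplementation and involution, the class lists the redundant axiom that the join of
  an element and its complement is the top; lemma \<open>orthomodular_neg_iff\<close> removes it.\<close>

definition orthomodular_neg :: "('a::bounded_lattice \<Rightarrow> 'a) \<Rightarrow> bool" where
  "orthomodular_neg neg \<longleftrightarrow>
     class.orthomodular_lattice (\<lambda>a b. inf a (neg b)) neg inf (\<le>) (<) sup bot top"

lemma orthomodular_neg_iff:
  fixes neg :: "'a::bounded_lattice \<Rightarrow> 'a"
  shows "orthomodular_neg neg \<longleftrightarrow>
    (\<forall>a b. a \<le> b \<longrightarrow> neg b \<le> neg a) \<and>
    (\<forall>a. inf a (neg a) = bot) \<and>
    (\<forall>a. neg (neg a) = a) \<and>
    (\<forall>a b. a \<le> b \<longrightarrow> b = sup a (inf (neg a) b))"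
    (is "?L \<longleftrightarrow> ?R")
proof
  assume ?L
  then interpret orthomodular_lattice "\<lambda>a b. inf a (neg b)" neg inf "(\<le>)" "(<)" sup bot top
    unfolding orthomodular_neg_def .
  show ?R using ortho_antimono orthomodular by auto
next
  assume R: ?R
  have "sup a (neg a) = top" for a
    using R by (metis inf_top_right top_greatest)
  with R show ?L
    unfolding orthomodular_neg_def by unfold_locales auto
qed

end

theory Submission
  imports Defs
begin

text \<open>For \<open>b \<le> a\<close> the orthomodular law is dual to the identity \<open>a \<sqinter> (\<not>a \<squnion> b) = b\<close>, which is
  modus ponens for the Sasaki hook. Conversely, \<open>\<not>a \<squnion> (a \<sqinter> b) \<le> a \<rightarrow> b\<close> holds for every
  preconditional, so modus ponens yields that identity. The relative complement of
  \<open>\<not>a \<squnion> (a \<sqinter> b)\<close> in \<open>a \<rightarrow> b\<close> lies below \<open>a \<sqinter> (a \<rightarrow> b) \<le> a \<sqinter> b\<close> and below \<open>\<not>(a \<sqinter> b)\<close>, so it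
  is zero and the hook is the whole implication.\<close>

context preconditional
begin

lemma imp_mono: "b \<le> c \<Longrightarrow> (a \<rightarrow> b) \<le> (a \<rightarrow> c)"
  by (metis imp_inf_le inf.absorb2)

text \<open>The element \<open>a \<rightarrow> bot\<close> serves as an intermediate consequent:
  monotonicity raises \<open>bot\<close> to it, and \<open>imp_inf_imp_le\<close> then drops the
  outer antecedent \<open>b\<close>, since the meet of \<open>b\<close> and \<open>a\<close> is
  \<open>a\<close>.\<close>

lemma imp_bot_antimono:
  assumes "a \<le> b"
  shows "(b \<rightarrow> bot) \<le> (a \<rightarrow> bot)"
proof -
  have "(b \<rightarrow> bot) \<le> (b \<rightarrow> (a \<rightarrow> bot))"
    by (rule imp_mono) simp
  also have "\<dots> \<le> (a \<rightarrow> bot)"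
    using imp_inf_imp_le[of b a bot] assms by (simp add: inf_absorb2)
  finally show ?thesis .
qed

lemma Sasaki_hook_le_imp: "sup (a \<rightarrow> bot) (inf a b) \<le> (a \<rightarrow> b)"
  by (simp add: imp_mono inf_le_imp)

end

text \<open>An antitone involution is an anti-automorphism of the order, so it exchanges joins and
  meets.\<close>

lemma de_Morgan_of_antimono_involution:
  fixes neg :: "'a::lattice \<Rightarrow> 'a"
  assumes anti: "\<And>a b. a \<le> b \<Longrightarrow> neg b \<le> neg a" and inv: "\<And>a. neg (neg a) = a"
  shows "neg (sup a b) = inf (neg a) (neg b)"
    and "neg (inf a b) = sup (neg a) (neg b)"
proof -
  have sup: "neg (sup x y) = inf (neg x) (neg y)" for x y
  proof (rule order.antisym)
    show "neg (sup x y) \<le> inf (neg x) (neg y)"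
      by (simp add: anti)
    have "x \<le> neg (inf (neg x) (neg y))" "y \<le> neg (inf (neg x) (neg y))"
      by (metis anti inv inf_le1, metis anti inv inf_le2)
    then have "sup x y \<le> neg (inf (neg x) (neg y))"
      by simp
    then show "inf (neg x) (neg y) \<le> neg (sup x y)"
      by (metis anti inv)
  qed
  show "neg (sup a b) = inf (neg a) (neg b)"
    by (rule sup)
  show "neg (inf a b) = sup (neg a) (neg b)"
    by (metis sup inv)
qed

text \<open>Either law, instantiated at the complements of \<open>a\<close> and \<open>b\<close> and
  then negated by de Morgan, becomes the other.\<close>

lemma orthomodular_neg_iff_inf:
  fixes neg :: "'a::bounded_lattice \<Rightarrow> 'a"
  assumes anti: "\<And>a b. a \<le> b \<Longrightarrow> neg b \<le> neg a" and inv: "\<And>a. neg (neg a) = a"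
    and semi: "\<And>a. inf a (neg a) = bot"
  shows "orthomodular_neg neg \<longleftrightarrow> (\<forall>a b. b \<le> a \<longrightarrow> inf a (sup (neg a) b) = b)"
proof -
  note de_Morgan = de_Morgan_of_antimono_involution[of neg, OF anti inv]
  have "(\<forall>a b :: 'a. a \<le> b \<longrightarrow> b = sup a (inf (neg a) b))
    \<longleftrightarrow> (\<forall>a b :: 'a. b \<le> a \<longrightarrow> inf a (sup (neg a) b) = b)"
  proof (intro iffI allI impI)
    fix a b :: 'a
    assume om: "\<forall>a b :: 'a. a \<le> b \<longrightarrow> b = sup a (inf (neg a) b)" and "b \<le> a"
    then have "neg b = sup (neg a) (inf a (neg b))"
      using anti inv by metis
    then show "inf a (sup (neg a) b) = b"
      by (metis de_Morgan inv)
  next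
    fix a b :: 'a
    assume om: "\<forall>a b :: 'a. b \<le> a \<longrightarrow> inf a (sup (neg a) b) = b" and "a \<le> b"
    then have "inf (neg a) (sup a (neg b)) = neg b"
      using anti inv by metis
    then show "b = sup a (inf (neg a) b)"
      by (metis de_Morgan inv)
  qed
  then show ?thesis
    using anti inv semi by (simp add: orthomodular_neg_iff)
qed

theorem proposition5:
  fixes imp :: "'a::bounded_lattice \<Rightarrow> 'a \<Rightarrow> 'a" (infixr "\<rightarrow>" 60)
  shows "(preconditional imp \<and>
          (\<forall>a b. inf a (a \<rightarrow> b) \<le> b) \<and>
          (\<forall>a. (a \<rightarrow> bot) \<rightarrow> bot = a))
     \<longleftrightarrow> (orthomodular_neg (\<lambda>a. a \<rightarrow> bot) \<and>
          (\<forall>a b. (a \<rightarrow> b) = sup (a \<rightarrow> bot) (inf a b)))"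
proof
  assume "preconditional imp \<and> (\<forall>a b. inf a (a \<rightarrow> b) \<le> b) \<and> (\<forall>a. (a \<rightarrow> bot) \<rightarrow> bot = a)"
  then have "preconditional imp" and mp: "\<And>a b. inf a (a \<rightarrow> b) \<le> b"
    and inv: "\<And>a. (a \<rightarrow> bot) \<rightarrow> bot = a"
    by auto
  interpret preconditional imp by fact
  have semi: "inf a (a \<rightarrow> bot) = bot" for a
    using mp[of a bot] by (simp add: bot_unique)
  have "inf a (sup (a \<rightarrow> bot) b) = b" if "b \<le> a" for a b
  proof (rule order.antisym)
    \<comment> \<open>As \<open>b \<le> a\<close>, the meet in the hook is \<open>b\<close>
      itself.\<close>
    have "inf a (sup (a \<rightarrow> bot) b) \<le> inf a (a \<rightarrow> b)"
      using Sasaki_hook_le_imp[of a b] that by (intro inf_mono) (simp_all add: inf_absorb2)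
    then show "inf a (sup (a \<rightarrow> bot) b) \<le> b"
      using mp by (rule order_trans)
  qed (simp add: that)
  then have om: "orthomodular_neg (\<lambda>a. a \<rightarrow> bot)"
    using orthomodular_neg_iff_inf[of "\<lambda>a. a \<rightarrow> bot"] imp_bot_antimono inv semi by auto
  have "(a \<rightarrow> b) = sup (a \<rightarrow> bot) (inf a b)" for a b
  proof -
    let ?s = "sup (a \<rightarrow> bot) (inf a b)"
    \<comment> \<open>Negating \<open>(a \<rightarrow> bot) \<le> ?s\<close> gives this by
      involution; it is what lets modus ponens apply to the relative complement.\<close>
    have le: "(?s \<rightarrow> bot) \<le> a"
      by (metis imp_bot_antimono inv sup_ge1)
    have "inf (?s \<rightarrow> bot) (a \<rightarrow> b) \<le> inf a b"
      by (meson le mp inf_mono le_infI le_infI1 order_refl order_trans)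
    also have "\<dots> \<le> ?s" by simp
    finally have "inf (?s \<rightarrow> bot) (a \<rightarrow> b) \<le> inf ?s (?s \<rightarrow> bot)" by simp
    then have "inf (?s \<rightarrow> bot) (a \<rightarrow> b) = bot"
      using semi[of ?s] by (simp add: bot_unique)
    \<comment> \<open>The orthomodular law for \<open>?s \<le> (a \<rightarrow> b)\<close>.\<close>
    moreover have "(a \<rightarrow> b) = sup ?s (inf (?s \<rightarrow> bot) (a \<rightarrow> b))"
      using om Sasaki_hook_le_imp unfolding orthomodular_neg_iff by blast
    ultimately show ?thesis by simp
  qed
  with om show "orthomodular_neg (\<lambda>a. a \<rightarrow> bot) \<and> (\<forall>a b. (a \<rightarrow> b) = sup (a \<rightarrow> bot) (inf a b))"
    by blast
next
  assume R: "orthomodular_neg (\<lambda>a. a \<rightarrow> bot) \<and> (\<forall>a b. (a \<rightarrow> b) = sup (a \<rightarrow> bot) (inf a b))"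
  then have hook: "\<And>a b. (a \<rightarrow> b) = sup (a \<rightarrow> bot) (inf a b)"
    and anti: "\<And>a b. a \<le> b \<Longrightarrow> (b \<rightarrow> bot) \<le> (a \<rightarrow> bot)"
    and inv: "\<And>a. (a \<rightarrow> bot) \<rightarrow> bot = a"
    and semi: "\<And>a. inf a (a \<rightarrow> bot) = bot"
    unfolding orthomodular_neg_iff by blast+
  have om: "inf a (sup (a \<rightarrow> bot) b) = b" if "b \<le> a" for a b
    using orthomodular_neg_iff_inf[of "\<lambda>a. a \<rightarrow> bot"] anti inv semi R that by blast
  have "preconditional imp"
  proof
    fix a b c
    show "(top \<rightarrow> a) \<le> a"
      \<comment> \<open>Semicomplementation at \<open>top\<close> makes
        \<open>top \<rightarrow> bot\<close> equal to \<open>bot\<close>, so the hook reduces to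
        \<open>a\<close>.\<close>
      using hook[of top a] semi[of top] by simp
    show "inf a b \<le> (a \<rightarrow> b)"
      by (subst hook) simp
    show "(a \<rightarrow> b) \<le> (a \<rightarrow> inf a b)"
      using hook[of a b] hook[of a "inf a b"] by simp
    show "(a \<rightarrow> inf b c) \<le> (a \<rightarrow> b)"
      by (subst hook[of a b], subst hook[of a "inf b c"]) (simp add: le_infI2 le_supI2)
    \<comment> \<open>Of the two joinands of the outer hook, the meet lies below
      \<open>inf a b \<rightarrow> c\<close> trivially; antitonicity handles
      \<open>a \<rightarrow> bot\<close>.\<close>
    have "(a \<rightarrow> bot) \<le> (inf a b \<rightarrow> bot)"
      by (simp add: anti)
    also have "\<dots> \<le> (inf a b \<rightarrow> c)"
      by (subst hook[of "inf a b" c]) simp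
    finally show "(a \<rightarrow> (inf a b \<rightarrow> c)) \<le> (inf a b \<rightarrow> c)"
      by (subst hook[of a "inf a b \<rightarrow> c"]) simp
  qed
  moreover have "inf a (a \<rightarrow> b) \<le> b" for a b
    \<comment> \<open>Taking \<open>inf a b\<close> as the smaller element shows that
      \<open>inf a (a \<rightarrow> b)\<close> equals \<open>inf a b\<close>.\<close>
    using om[of "inf a b" a] hook[of a b] by simp
  ultimately show "preconditional imp \<and> (\<forall>a b. inf a (a \<rightarrow> b) \<le> b) \<and> (\<forall>a. (a \<rightarrow> bot) \<rightarrow> bot = a)"
    using inv by blast
qed

end
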